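(* (Noninterference Half-Off Theorem.) Consider any system consisting of a pure language, an effectful (type-and-effect) language and a program-counter (pc) type system for the effectful programs, as described in the context, that satisfies all of the rules Seq$_\le$, Seq, Capture, Map, Join, CapturedSeq, ProtectC, EquivCap, PcEff and ProtectTrans. Suppose that every well-typed pure program is noninterfering with respect to $\approx_{-}$. Then every effectful program that is well-typed in the pc system is noninterfering with respect to $\cong^{\varepsilon}_{-}$. Explicitly: whenever $t\diamond \mathrm{pc}\vdash_{PC} r\dashv t'$, there is an effect $\varepsilon_1$ such that $[\![t]\!]\vdash_E r\dashv[\![t']\!]\diamond\varepsilon_1$ and $r$, with this typing, is noninterfering in the effectful sense defined in the context.
   Context: **Labels and effects.** $\mathcal L$ is a set of labels preordered by $\sqsubseteq$ (with joins and a top element). $\mathcal E$ is an *effector*: a set of effects with a relation $[\varepsilon_1,\dots,\varepsilon_n]\le\varepsilon$ (for every $n\ge 0$) satisfying identity ($[\varepsilon]\le\varepsilon$) and associativity (if $[\varepsilon_{i,1},\dots,\varepsilon_{i,k_i}]\le\varepsilon_i$ for each $i$ and $[\varepsilon_1,\dots,\varepsilon_n]\le\varepsilon$ then $[\varepsilon_{1,1},\dots,\varepsilon_{n,k_n}]\le\varepsilon$). A function $\varepsilon\mapsto\ell_\varepsilon$ from $\mathcal E$ to $\mathcal L$ is given. **Languages.** All types, programs and judgments are abstract. - *Effectful language*: types $t$, programs $p$, judgment $t\vdash_E p\dashv t'\diamond\varepsilon$ ($p$ has input type $t$, output type $t'$, effect $\varepsilon$), a sequential composition $p_1;\dots;p_n$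 ($n\ge0$; for $n=1$ it is $p_1$ itself, for $n=0$ the identity program), a protection relation $\ell\triangleleft t$ between labels and types, and for every label $\ell$ and effect $\varepsilon$ an equivalence relation $\cong^{\varepsilon}_{\ell}$ on programs. - *Pure language*: types $\tau$, programs $\rho$, judgment $\tau\vdash_P\rho\dashv\tau'$, sequential composition $\rho_1;\dots;\rho_n$ (associative and unital up to equality of programs), a protection relation $\ell\triangleleft\tau$, an equality $\rho_1=_{\tau,\tau'}\rho_2$ of pure programs from $\tau$ to $\tau'$, and for every label $\ell$ an equivalence relation $\approx_\ell$ on programs, which respects this equality. - *pc system*: its own types (also written $t$), the same programs as the effectful language, judgment $t\diamond\mathrm{pc}\vdash_{PC}p\dashv t'$ with $\mathrm{pc}\in\mathcal L$, a protection relation $\ell\triangleleft t$, and a translation $[\![-]\!]$ from pc types to effectful types. **Translation to pure programs.** There are a translation $(\!|-|\!)$ from effectful types to pure types, a pure type transformer $P_\varepsilon(-)$ for each $\varepsilon$, a capture operation $\lfloor p\rfloor_\varepsilon$ from effectful programs of effect $\varepsilon$ to pure programs, an operation $\mathrm{map}_\varepsilon$ on pure programs, and pure programs $\mathrm{join}_{[\varepsilon_1,\dots,\varepsilon_n],\varepsilon}$. **Rules.** - Seq$_\le$: if $t_{i-1}\vdash_E p_i\dashv t_i\diamond\varepsilon_i$ for $1\le i\le n$ and $[\varepsilon_1,\dots,\varepsilon_n]\le\varepsilon$, then $t_0\vdash_E p_1;\dots;p_n\dashv t_n\diamond\varepsilon$. - Seq: if $\tau_{i-1}\vdash_P\rho_i\dashv\tau_i$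 for $1\le i\le n$, then $\tau_0\vdash_P\rho_1;\dots;\rho_n\dashv\tau_n$. - Capture: if $t\vdash_E p\dashv t'\diamond\varepsilon$ then $(\!|t|\!)\vdash_P\lfloor p\rfloor_\varepsilon\dashv P_\varepsilon(\!|t'|\!)$. - Map: if $\tau\vdash_P\rho\dashv\tau'$ then $P_\varepsilon(\tau)\vdash_P\mathrm{map}_\varepsilon(\rho)\dashv P_\varepsilon(\tau')$. - Join: if $[\varepsilon_1,\dots,\varepsilon_n]\le\varepsilon$ then $P_{\varepsilon_1}(\cdots P_{\varepsilon_n}(\tau)\cdots)\vdash_P\mathrm{join}_{[\varepsilon_1,\dots,\varepsilon_n],\varepsilon}\dashv P_\varepsilon(\tau)$. - CapturedSeq: if $t_{i-1}\vdash_E p_i\dashv t_i\diamond\varepsilon_i$ for $1\le i\le n$ and $[\varepsilon_1,\dots,\varepsilon_n]\le\varepsilon$, then $\lfloor p_1;\dots;p_n\rfloor_\varepsilon=_{(\!|t_0|\!),P_\varepsilon(\!|t_n|\!)}\lfloor p_1\rfloor_{\varepsilon_1};\mathrm{map}_{\varepsilon_1}(\lfloor p_2\rfloor_{\varepsilon_2};\mathrm{map}_{\varepsilon_2}(\cdots(\lfloor p_n\rfloor_{\varepsilon_n})));\mathrm{join}_{[\varepsilon_1,\dots,\varepsilon_n],\varepsilon}$. - ProtectC: if $\ell\sqsubseteq\ell_\varepsilon$ and $\ell\triangleleft t$ then $\ell\triangleleft P_\varepsilon(\!|t|\!)$. - EquivCap: if $\lfloor p\rfloor_\varepsilon\approx_\ell\lfloor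 q\rfloor_\varepsilon$ then $p\cong^\varepsilon_\ell q$. - PcEff: if $t\diamond\mathrm{pc}\vdash_{PC}p\dashv t'$ then there exists $\varepsilon$ with $[\![t]\!]\vdash_E p\dashv[\![t']\!]\diamond\varepsilon$. - ProtectTrans: if $\ell\triangleleft t$ in the pc system then $\ell\triangleleft[\![t]\!]$ in the effectful language. **Noninterference.** An effectful program $r$ with $t_1\vdash_E r\dashv t_2\diamond\varepsilon_1$ is *noninterfering with respect to $\cong^{\varepsilon}_{-}$* if for all labels $\ell$, all types $t_3$, all effects $\varepsilon_2,\varepsilon$ and all programs $p,q$ such that (1) $t_3\vdash_E p\dashv t_1\diamond\varepsilon_2$ and $t_3\vdash_E q\dashv t_1\diamond\varepsilon_2$ with $[\varepsilon_2,\varepsilon_1]\le\varepsilon$, and (2) $\ell\triangleleft t_1$ and $\ell\sqsubseteq\ell_{\varepsilon_2}$, we have for every label $\ell_{\mathsf{Atk}}\in\mathcal L$: either $\ell\sqsubseteq\ell_{\mathsf{Atk}}$ or $p;r\cong^{\varepsilon}_{\ell_{\mathsf{Atk}}}q;r$. A pure program $\rho$ with $\tau_1\vdash_P\rho\dashv\tau_2$ is *noninterfering with respect to $\approx_{-}$* if for all labels $\ell$ with $\ell\triangleleft\tau_1$, all $\tau_3$ and all pure $\pi,\pi'$ with $\tau_3\vdash_P\pi\dashv\tau_1$ and $\tau_3\vdash_P\pi'\dashv\tau_1$, for every label $\ell_{\mathsf{Atk}}$ either $\ell\sqsubseteq\ell_{\mathsf{Atk}}$ or $\pi;\rho\approx_{\ell_{\mathsf{Atk}}}\pi';\rho$.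 *)

theory Defs
  imports Main
begin

locale label_preorder = partial_preordering leq
  for leq :: "'l \<Rightarrow> 'l \<Rightarrow> bool" +
  assumes joins: "\<exists>j. leq a j \<and> leq b j \<and> (\<forall>u. leq a u \<longrightarrow> leq b u \<longrightarrow> leq j u)"
    and top: "\<exists>m. \<forall>a. leq a m"

locale effector =
  fixes eff_le :: "'e list \<Rightarrow> 'e \<Rightarrow> bool"
  assumes eff_identity: "eff_le [\<epsilon>] \<epsilon>"
    and eff_assoc: "list_all2 eff_le \<epsilon>ss \<epsilon>s \<Longrightarrow> eff_le \<epsilon>s \<epsilon> \<Longrightarrow> eff_le (concat \<epsilon>ss) \<epsilon>"

text \<open>
  \<open>typed_path J t [x\<^sub>1, \<dots>, x\<^sub>n] t'\<close> says that there are intermediate types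
  \<open>t = t\<^sub>0, t\<^sub>1, \<dots>, t\<^sub>n = t'\<close> with \<open>J t\<^sub>i\<^sub>-\<^sub>1 x\<^sub>i t\<^sub>i\<close> for all \<open>i\<close>.
\<close>

primrec typed_path :: "('t \<Rightarrow> 'x \<Rightarrow> 't \<Rightarrow> bool) \<Rightarrow> 't \<Rightarrow> 'x list \<Rightarrow> 't \<Rightarrow> bool" where
  "typed_path J t [] t' \<longleftrightarrow> t = t'"
| "typed_path J t (x # xs) t' \<longleftrightarrow> (\<exists>u. J t x u \<and> typed_path J u xs t')"

text \<open>
  \<open>eff_typing E t p t' \<epsilon>\<close> is \<open>t \<turnstile> p \<stileturn> t' \<diamond> \<epsilon>\<close>, and \<open>eff_equiv E \<epsilon> l p q\<close> is \<open>p \<cong> q\<close> at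
  effect \<open>\<epsilon>\<close> and label \<open>l\<close>. The program \<open>eff_seq E []\<close> is the identity program.
\<close>

record ('t, 'p, 'e, 'l) eff_lang =
  eff_typing :: "'t \<Rightarrow> 'p \<Rightarrow> 't \<Rightarrow> 'e \<Rightarrow> bool"
  eff_seq :: "'p list \<Rightarrow> 'p"
  eff_protect :: "'l \<Rightarrow> 't \<Rightarrow> bool"
  eff_equiv :: "'e \<Rightarrow> 'l \<Rightarrow> 'p \<Rightarrow> 'p \<Rightarrow> bool"

text \<open>
  \<open>pure_eq P \<tau> \<tau>' \<rho>\<^sub>1 \<rho>\<^sub>2\<close> is the equality of programs from \<open>\<tau>\<close> to \<open>\<tau>'\<close>, and
  \<open>pure_equiv P l \<rho>\<^sub>1 \<rho>\<^sub>2\<close> is \<open>\<rho>\<^sub>1 \<approx> \<rho>\<^sub>2\<close> at label \<open>l\<close>.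
\<close>

record ('u, 'r, 'l) pure_lang =
  pure_typing :: "'u \<Rightarrow> 'r \<Rightarrow> 'u \<Rightarrow> bool"
  pure_seq :: "'r list \<Rightarrow> 'r"
  pure_protect :: "'l \<Rightarrow> 'u \<Rightarrow> bool"
  pure_eq :: "'u \<Rightarrow> 'u \<Rightarrow> 'r \<Rightarrow> 'r \<Rightarrow> bool"
  pure_equiv :: "'l \<Rightarrow> 'r \<Rightarrow> 'r \<Rightarrow> bool"

text \<open>\<open>pc_typing C t pc p t'\<close> is \<open>t \<diamond> pc \<turnstile> p \<stileturn> t'\<close>.\<close>

record ('c, 'p, 't, 'l) pc_system =
  pc_typing :: "'c \<Rightarrow> 'l \<Rightarrow> 'p \<Rightarrow> 'c \<Rightarrow> bool"
  pc_protect :: "'l \<Rightarrow> 'c \<Rightarrow> bool"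
  pc_trans :: "'c \<Rightarrow> 't"

record ('t, 'p, 'e, 'u, 'r) pure_trans =
  trans_type :: "'t \<Rightarrow> 'u"
  eff_type :: "'e \<Rightarrow> 'u \<Rightarrow> 'u"
  capture :: "'e \<Rightarrow> 'p \<Rightarrow> 'r"
  map_eff :: "'e \<Rightarrow> 'r \<Rightarrow> 'r"
  join_eff :: "'e list \<Rightarrow> 'e \<Rightarrow> 'r"

locale effectful_language =
  fixes E :: "('t, 'p, 'e, 'l) eff_lang"
  assumes eff_seq_single: "eff_seq E [p] = p"
    and eff_equiv_equivp: "equivp (eff_equiv E \<epsilon> l)"

text \<open>
  Associativity and unitality hold only up to the typed equality. \<open>seq_flatten\<close> removes an
  inner pair of brackets at any position; for \<open>\<sigma>s = []\<close> it removes an identity program.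
  Congruence of the typed equality with respect to composition is not assumed, which is why
  the context \<open>\<rho>s, \<rho>s'\<close> is part of the law.
\<close>

locale pure_language =
  fixes P :: "('u, 'r, 'l) pure_lang"
  assumes pure_eq_equiv:
      "equiv {\<rho>. pure_typing P \<tau> \<rho> \<tau>'} {(\<rho>1, \<rho>2). pure_eq P \<tau> \<tau>' \<rho>1 \<rho>2}"
    and seq_single:
      "pure_typing P \<tau> \<rho> \<tau>' \<Longrightarrow> pure_eq P \<tau> \<tau>' (pure_seq P [\<rho>]) \<rho>"
    and seq_flatten:
      "\<lbrakk>typed_path (pure_typing P) \<tau>\<^sub>0 \<rho>s \<tau>\<^sub>1;
        typed_path (pure_typing P) \<tau>\<^sub>1 \<sigma>s \<tau>\<^sub>2;
        typed_path (pure_typing P) \<tau>\<^sub>2 \<rho>s' \<tau>\<^sub>3\<rbrakk>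
       \<Longrightarrow> pure_eq P \<tau>\<^sub>0 \<tau>\<^sub>3
             (pure_seq P (\<rho>s @ [pure_seq P \<sigma>s] @ \<rho>s')) (pure_seq P (\<rho>s @ \<sigma>s @ \<rho>s'))"
    and pure_equiv_equivp: "equivp (pure_equiv P l)"
    and pure_equiv_respects:
      "\<lbrakk>pure_eq P \<tau> \<tau>' \<rho>1 \<rho>1'; pure_eq P \<tau> \<tau>' \<rho>2 \<rho>2'; pure_equiv P l \<rho>1 \<rho>2\<rbrakk>
       \<Longrightarrow> pure_equiv P l \<rho>1' \<rho>2'"

text \<open>
  With \<open>c\<^sub>i = capture T \<epsilon>\<^sub>i p\<^sub>i\<close>, \<open>nested_capture P T (\<epsilon>\<^sub>1, p\<^sub>1) [(\<epsilon>\<^sub>2, p\<^sub>2), \<dots>, (\<epsilon>\<^sub>n, p\<^sub>n)]\<close> is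
  \<open>c\<^sub>1; map \<epsilon>\<^sub>1 (c\<^sub>2; map \<epsilon>\<^sub>2 (\<dots> c\<^sub>n))\<close>. The flat sequence \<open>captured_seq\<close> is
  \<open>c\<^sub>1; map \<epsilon>\<^sub>1 (c\<^sub>2; map \<epsilon>\<^sub>2 (\<dots> c\<^sub>n)); join\<close>, which for \<open>n = 1\<close> is \<open>c\<^sub>1; join\<close> and for
  \<open>n = 0\<close> is \<open>join\<close>.
\<close>

fun nested_capture ::
  "('u, 'r, 'l) pure_lang \<Rightarrow> ('t, 'p, 'e, 'u, 'r) pure_trans \<Rightarrow> 'e \<times> 'p \<Rightarrow> ('e \<times> 'p) list \<Rightarrow> 'r"
where
  "nested_capture P T (\<epsilon>, p) [] = capture T \<epsilon> p"
| "nested_capture P T (\<epsilon>, p) (y # ys) =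
     pure_seq P [capture T \<epsilon> p, map_eff T \<epsilon> (nested_capture P T y ys)]"

fun captured_seq ::
  "('u, 'r, 'l) pure_lang \<Rightarrow> ('t, 'p, 'e, 'u, 'r) pure_trans \<Rightarrow> ('e \<times> 'p) list \<Rightarrow> 'e \<Rightarrow> 'r"
where
  "captured_seq P T [] \<epsilon> = join_eff T [] \<epsilon>"
| "captured_seq P T [(\<epsilon>1, p1)] \<epsilon> = pure_seq P [capture T \<epsilon>1 p1, join_eff T [\<epsilon>1] \<epsilon>]"
| "captured_seq P T ((\<epsilon>1, p1) # y # ys) \<epsilon> =
     pure_seq P [capture T \<epsilon>1 p1, map_eff T \<epsilon>1 (nested_capture P T y ys),
       join_eff T (\<epsilon>1 # map fst (y # ys)) \<epsilon>]"

text \<open>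
  A sequence of effectful programs is a list of pairs \<open>(\<epsilon>\<^sub>i, p\<^sub>i)\<close>. The operation \<open>capture T \<epsilon>\<close>
  is meaningful only on programs of effect \<open>\<epsilon>\<close>, so \<open>EquivCap\<close> is required only for such
  programs (their types are arbitrary and may differ).
\<close>

locale half_off_system =
  label_preorder leq +
  effector eff_le +
  effectful_language E +
  pure_language P
  for leq :: "'l \<Rightarrow> 'l \<Rightarrow> bool"
    and eff_le :: "'e list \<Rightarrow> 'e \<Rightarrow> bool"
    and lab :: "'e \<Rightarrow> 'l"
    and E :: "('t, 'p, 'e, 'l) eff_lang"
    and P :: "('u, 'r, 'l) pure_lang"
    and C :: "('c, 'p, 't, 'l) pc_system"
    and T :: "('t, 'p, 'e, 'u, 'r) pure_trans" +
  assumes Seq_le: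
      "\<lbrakk>typed_path (\<lambda>t (\<epsilon>, p) t'. eff_typing E t p t' \<epsilon>) t xs t'; eff_le (map fst xs) \<epsilon>\<rbrakk>
       \<Longrightarrow> eff_typing E t (eff_seq E (map snd xs)) t' \<epsilon>"
    and Seq:
      "typed_path (pure_typing P) \<tau> \<rho>s \<tau>' \<Longrightarrow> pure_typing P \<tau> (pure_seq P \<rho>s) \<tau>'"
    and Capture:
      "eff_typing E t p t' \<epsilon> \<Longrightarrow>
       pure_typing P (trans_type T t) (capture T \<epsilon> p) (eff_type T \<epsilon> (trans_type T t'))"
    and Map:
      "pure_typing P \<tau> \<rho> \<tau>' \<Longrightarrow>
       pure_typing P (eff_type T \<epsilon> \<tau>) (map_eff T \<epsilon> \<rho>) (eff_type T \<epsilon> \<tau>')"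
    and Join:
      "eff_le \<epsilon>s \<epsilon> \<Longrightarrow>
       pure_typing P (foldr (eff_type T) \<epsilon>s \<tau>) (join_eff T \<epsilon>s \<epsilon>) (eff_type T \<epsilon> \<tau>)"
    and CapturedSeq:
      "\<lbrakk>typed_path (\<lambda>t (\<epsilon>, p) t'. eff_typing E t p t' \<epsilon>) t xs t'; eff_le (map fst xs) \<epsilon>\<rbrakk>
       \<Longrightarrow> pure_eq P (trans_type T t) (eff_type T \<epsilon> (trans_type T t'))
             (capture T \<epsilon> (eff_seq E (map snd xs))) (captured_seq P T xs \<epsilon>)"
    and ProtectC:
      "\<lbrakk>leq l (lab \<epsilon>); eff_protect E l t\<rbrakk> \<Longrightarrow> pure_protect P l (eff_type T \<epsilon> (trans_type T t))"
    and EquivCap: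
      "\<lbrakk>eff_typing E t p t' \<epsilon>; eff_typing E s q s' \<epsilon>;
        pure_equiv P l (capture T \<epsilon> p) (capture T \<epsilon> q)\<rbrakk>
       \<Longrightarrow> eff_equiv E \<epsilon> l p q"
    and PcEff:
      "pc_typing C c pc p c' \<Longrightarrow> \<exists>\<epsilon>. eff_typing E (pc_trans C c) p (pc_trans C c') \<epsilon>"
    and ProtectTrans:
      "pc_protect C l c \<Longrightarrow> eff_protect E l (pc_trans C c)"

text \<open>
  Noninterference refers to a typing \<open>eff_typing E t\<^sub>1 r t\<^sub>2 \<epsilon>\<^sub>1\<close> (resp.
  \<open>pure_typing P \<tau>\<^sub>1 \<rho> \<tau>\<^sub>2\<close>), of which only \<open>t\<^sub>1\<close> and \<open>\<epsilon>\<^sub>1\<close> (resp. \<open>\<tau>\<^sub>1\<close>) occur in the condition.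
\<close>

definition eff_noninterfering ::
  "('l \<Rightarrow> 'l \<Rightarrow> bool) \<Rightarrow> ('e list \<Rightarrow> 'e \<Rightarrow> bool) \<Rightarrow> ('e \<Rightarrow> 'l) \<Rightarrow> ('t, 'p, 'e, 'l) eff_lang \<Rightarrow>
   't \<Rightarrow> 'p \<Rightarrow> 'e \<Rightarrow> bool"
where
  "eff_noninterfering leq eff_le lab E t1 r \<epsilon>1 \<longleftrightarrow>
     (\<forall>l t3 \<epsilon>2 \<epsilon> p q.
        eff_typing E t3 p t1 \<epsilon>2 \<and> eff_typing E t3 q t1 \<epsilon>2 \<and> eff_le [\<epsilon>2, \<epsilon>1] \<epsilon> \<and>
        eff_protect E l t1 \<and> leq l (lab \<epsilon>2) \<longrightarrow>
        (\<forall>atk. leq l atk \<or> eff_equiv E \<epsilon> atk (eff_seq E [p, r]) (eff_seq E [q, r])))"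

definition pure_noninterfering ::
  "('l \<Rightarrow> 'l \<Rightarrow> bool) \<Rightarrow> ('u, 'r, 'l) pure_lang \<Rightarrow> 'u \<Rightarrow> 'r \<Rightarrow> bool"
where
  "pure_noninterfering leq P \<tau>1 \<rho> \<longleftrightarrow>
     (\<forall>l \<tau>3 \<pi> \<pi>'.
        pure_protect P l \<tau>1 \<and> pure_typing P \<tau>3 \<pi> \<tau>1 \<and> pure_typing P \<tau>3 \<pi>' \<tau>1 \<longrightarrow>
        (\<forall>atk. leq l atk \<or> pure_equiv P atk (pure_seq P [\<pi>, \<rho>]) (pure_seq P [\<pi>', \<rho>])))"

end

theory Submission
  imports Defs
begin

text \<open>
  By \<open>CapturedSeq\<close> the capture of \<open>p; r\<close> is the capture of \<open>p\<close> followed by a pure program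
  \<open>\<rho>\<close> that depends on \<open>r\<close> only, namely \<open>map (capture r); join\<close>. Its input type is
  protected by \<open>ProtectC\<close>, so noninterference of \<open>\<rho>\<close> relates the captures of \<open>p; r\<close> and
  \<open>q; r\<close>, and \<open>EquivCap\<close> transfers this back to the effectful programs.
\<close>

context half_off_system
begin

lemma pure_eq_sym: "pure_eq P \<tau> \<tau>' \<rho> \<rho>' \<Longrightarrow> pure_eq P \<tau> \<tau>' \<rho>' \<rho>"
  using pure_eq_equiv[of \<tau> \<tau>'] by (auto simp: equiv_def dest: symD)

lemma pure_eq_trans:
  "pure_eq P \<tau> \<tau>' \<rho> \<rho>' \<Longrightarrow> pure_eq P \<tau> \<tau>' \<rho>' \<rho>'' \<Longrightarrow> pure_eq P \<tau> \<tau>' \<rho> \<rho>''"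
  using pure_eq_equiv[of \<tau> \<tau>'] by (auto simp: equiv_def dest: transD)

text \<open>Map and join are bracketed into one program because pure noninterference speaks of
  sequences of the form \<open>[\<pi>, \<rho>]\<close>.\<close>

definition captured_tail :: "'e \<Rightarrow> 'e \<Rightarrow> 'e \<Rightarrow> 'p \<Rightarrow> 'r" where
  "captured_tail \<epsilon>2 \<epsilon>1 \<epsilon> r = pure_seq P [map_eff T \<epsilon>2 (capture T \<epsilon>1 r), join_eff T [\<epsilon>2, \<epsilon>1] \<epsilon>]"

text \<open>The two programs meet at \<open>eff_type T \<epsilon>2 (eff_type T \<epsilon>1
  (trans_type T t'))\<close>, which is the \<open>foldr\<close> type in \<open>Join\<close>
  unfolded. The path form serves both \<open>Seq\<close> and \<open>seq_flatten\<close>.\<close>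

lemma captured_tail_path:
  assumes "eff_typing E t r t' \<epsilon>1" and "eff_le [\<epsilon>2, \<epsilon>1] \<epsilon>"
  shows "typed_path (pure_typing P) (eff_type T \<epsilon>2 (trans_type T t))
    [map_eff T \<epsilon>2 (capture T \<epsilon>1 r), join_eff T [\<epsilon>2, \<epsilon>1] \<epsilon>] (eff_type T \<epsilon> (trans_type T t'))"
  using Map[OF Capture[OF assms(1)]] Join[OF assms(2), of "trans_type T t'"] by auto

lemma captured_tail_typing:
  assumes "eff_typing E t r t' \<epsilon>1" and "eff_le [\<epsilon>2, \<epsilon>1] \<epsilon>"
  shows "pure_typing P (eff_type T \<epsilon>2 (trans_type T t)) (captured_tail \<epsilon>2 \<epsilon>1 \<epsilon> r)
    (eff_type T \<epsilon> (trans_type T t'))"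
  unfolding captured_tail_def by (rule Seq[OF captured_tail_path[OF assms]])

text \<open>\<open>CapturedSeq\<close> gives a flat sequence of three programs; regrouping its last
  two isolates the tail.\<close>

lemma capture_seq_pair:
  assumes p: "eff_typing E s p t \<epsilon>2" and r: "eff_typing E t r t' \<epsilon>1" and le: "eff_le [\<epsilon>2, \<epsilon>1] \<epsilon>"
  shows "pure_eq P (trans_type T s) (eff_type T \<epsilon> (trans_type T t'))
    (capture T \<epsilon> (eff_seq E [p, r])) (pure_seq P [capture T \<epsilon>2 p, captured_tail \<epsilon>2 \<epsilon>1 \<epsilon> r])"
proof -
  let ?eq = "pure_eq P (trans_type T s) (eff_type T \<epsilon> (trans_type T t'))"
  let ?flat = "pure_seq P [capture T \<epsilon>2 p, map_eff T \<epsilon>2 (capture T \<epsilon>1 r), join_eff T [\<epsilon>2, \<epsilon>1] \<epsilon>]"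
  have "?eq (capture T \<epsilon> (eff_seq E [p, r])) ?flat"
    using CapturedSeq[of s "[(\<epsilon>2, p), (\<epsilon>1, r)]" t' \<epsilon>] p r le by auto
  \<comment> \<open>\<open>seq_flatten\<close> opens the tail, with the capture of \<open>p\<close>
    to its left and nothing to its right; symmetry then turns this into the regrouping.\<close>
  moreover have "?eq (pure_seq P [capture T \<epsilon>2 p, captured_tail \<epsilon>2 \<epsilon>1 \<epsilon> r]) ?flat"
    using seq_flatten[OF _ captured_tail_path[OF r le],
        of "trans_type T s" "[capture T \<epsilon>2 p]" "[]" "eff_type T \<epsilon> (trans_type T t')"] Capture[OF p]
    by (simp add: captured_tail_def)
  ultimately show ?thesis
    by (blast intro: pure_eq_sym pure_eq_trans)
qed

text \<open>The typing of \<open>r\<close> is arbitrary, so the lemma fits whichever effect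
  \<open>PcEff\<close> supplies.\<close>

lemma eff_noninterferingI:
  assumes pure: "\<And>\<tau>1 \<rho> \<tau>2. pure_typing P \<tau>1 \<rho> \<tau>2 \<Longrightarrow> pure_noninterfering leq P \<tau>1 \<rho>"
    and r: "eff_typing E t r t' \<epsilon>1"
  shows "eff_noninterfering leq eff_le lab E t r \<epsilon>1"
  unfolding eff_noninterfering_def
proof (intro allI impI, elim conjE)
  fix l s \<epsilon>2 \<epsilon> p q atk
  assume p: "eff_typing E s p t \<epsilon>2" and q: "eff_typing E s q t \<epsilon>2"
    and le: "eff_le [\<epsilon>2, \<epsilon>1] \<epsilon>" and prot: "eff_protect E l t" and lab: "leq l (lab \<epsilon>2)"
  \<comment> \<open>\<open>EquivCap\<close> asks that both composites be typed at effect
    \<open>\<epsilon>\<close>.\<close>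
  have typing: "eff_typing E s (eff_seq E [x, r]) t' \<epsilon>" if "eff_typing E s x t \<epsilon>2" for x
    using Seq_le[of s "[(\<epsilon>2, x), (\<epsilon>1, r)]" t' \<epsilon>] that r le by auto
  show "leq l atk \<or> eff_equiv E \<epsilon> atk (eff_seq E [p, r]) (eff_seq E [q, r])"
    unfolding disj_imp
  proof (rule impI)
    assume "\<not> leq l atk"
    \<comment> \<open>The captures of \<open>p\<close> and \<open>q\<close> play the roles of
      \<open>\<pi>\<close> and \<open>\<pi>'\<close>, with \<open>trans_type T s\<close> as
      \<open>\<tau>3\<close>; \<open>ProtectC\<close> protects the type where they meet the
      tail.\<close>
    then have "pure_equiv P atk (pure_seq P [capture T \<epsilon>2 p, captured_tail \<epsilon>2 \<epsilon>1 \<epsilon> r])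
        (pure_seq P [capture T \<epsilon>2 q, captured_tail \<epsilon>2 \<epsilon>1 \<epsilon> r])"
      using pure[OF captured_tail_typing[OF r le]] ProtectC[OF lab prot] Capture[OF p] Capture[OF q]
      unfolding pure_noninterfering_def by blast
    then have "pure_equiv P atk (capture T \<epsilon> (eff_seq E [p, r])) (capture T \<epsilon> (eff_seq E [q, r]))"
      \<comment> \<open>The equalities are reversed to lead from the regrouped sequences back to the
        captured composites.\<close>
      by (rule pure_equiv_respects[OF pure_eq_sym[OF capture_seq_pair[OF p r le]]
            pure_eq_sym[OF capture_seq_pair[OF q r le]]])
    then show "eff_equiv E \<epsilon> atk (eff_seq E [p, r]) (eff_seq E [q, r])"
      by (rule EquivCap[OF typing[OF p] typing[OF q]])
  qed
qed

end

theorem theorem5: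
  fixes leq :: "'l \<Rightarrow> 'l \<Rightarrow> bool"
    and eff_le :: "'e list \<Rightarrow> 'e \<Rightarrow> bool"
    and lab :: "'e \<Rightarrow> 'l"
    and E :: "('t, 'p, 'e, 'l) eff_lang"
    and P :: "('u, 'r, 'l) pure_lang"
    and C :: "('c, 'p, 't, 'l) pc_system"
    and T :: "('t, 'p, 'e, 'u, 'r) pure_trans"
  assumes "half_off_system leq eff_le lab E P C T"
    and "\<And>\<tau>1 \<rho> \<tau>2. pure_typing P \<tau>1 \<rho> \<tau>2 \<Longrightarrow> pure_noninterfering leq P \<tau>1 \<rho>"
    and "pc_typing C t pc r t'"
  shows "\<exists>\<epsilon>1. eff_typing E (pc_trans C t) r (pc_trans C t') \<epsilon>1 \<and>
           eff_noninterfering leq eff_le lab E (pc_trans C t) r \<epsilon>1"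
proof -
  interpret half_off_system leq eff_le lab E P C T
    by (fact assms(1))
  obtain \<epsilon>1 where r: "eff_typing E (pc_trans C t) r (pc_trans C t') \<epsilon>1"
    using PcEff[OF assms(3)] by blast
  have "eff_noninterfering leq eff_le lab E (pc_trans C t) r \<epsilon>1"
    by (rule eff_noninterferingI[OF _ r]) (rule assms(2))
  with r show ?thesis
    by blast
qed

end
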